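(* A topometric space admits a compactification if and only if it is completely regular.
   Context: A topometric space is a triple $(X,\mathcal T,d)$ where $\mathcal T$ is a topology on $X$ and $d\colon X\times X\to[0,\infty]$ is a metric (possibly taking the value $\infty$) such that $d$ is lower semi-continuous with respect to $\mathcal T\times\mathcal T$ and every $\mathcal T$-open set is open in the metric topology of $d$. Unqualified topological terms refer to $\mathcal T$, metric terms to $d$. $\mathcal C_{\mathcal L(1)}(X)$ denotes the set of functions $f\colon X\to\mathbb C$ that are continuous and $1$-Lipschitz ($|f(x)-f(y)|\le d(x,y)$). A family $\mathcal F$ of functions $X\to\mathbb C$ separates points from closed sets if for every closed $F\subseteq X$ and $x\in X\setminus F$ some $f\in\mathcal F$ is constant on $F$ and takes a different value at $x$. $X$ is completely regular if $\mathcal C_{\mathcal L(1)}(X)$ separates points from closed sets and $d(x,y)=\sup\{|f(x)-f(y)|: f\in\mathcal C_{\mathcal L(1)}(X)\}$ for all $x,y$. A subset of a topometric space carries the induced topology and restricted metric; an embedding is an isometric map that is a homeomorphism onto its image. A compactification of $X$ is a compact topometric space containing an embedded copy of $X$ as a topologically dense subspace. *)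

theory Defs
  imports "HOL-Analysis.Analysis"
begin

text \<open>
  A topometric space is given by an abstract topology \<open>T\<close>, whose \<open>topspace\<close> is the underlying set,
  and a distance function \<open>d\<close> with values in \<open>[0, \<infinity>]\<close>. Only the values of \<open>d\<close> on
  \<open>topspace T\<close> matter.
\<close>

definition ext_metric_on :: "'a set \<Rightarrow> ('a \<Rightarrow> 'a \<Rightarrow> ennreal) \<Rightarrow> bool" where
  "ext_metric_on X d \<longleftrightarrow>
     (\<forall>x\<in>X. \<forall>y\<in>X. d x y = 0 \<longleftrightarrow> x = y) \<and>
     (\<forall>x\<in>X. \<forall>y\<in>X. d x y = d y x) \<and>
     (\<forall>x\<in>X. \<forall>y\<in>X. \<forall>z\<in>X. d x z \<le> d x y + d y z)"

definition ext_metric_open :: "'a set \<Rightarrow> ('a \<Rightarrow> 'a \<Rightarrow> ennreal) \<Rightarrow> 'a set \<Rightarrow> bool" where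
  "ext_metric_open X d U \<longleftrightarrow>
     U \<subseteq> X \<and> (\<forall>x\<in>U. \<exists>r>0. {y \<in> X. d x y < r} \<subseteq> U)"

definition lower_semicont :: "'a topology \<Rightarrow> ('a \<Rightarrow> ennreal) \<Rightarrow> bool" where
  "lower_semicont T f \<longleftrightarrow> (\<forall>r. openin T {x \<in> topspace T. r < f x})"

definition topometric :: "'a topology \<Rightarrow> ('a \<Rightarrow> 'a \<Rightarrow> ennreal) \<Rightarrow> bool" where
  "topometric T d \<longleftrightarrow>
     ext_metric_on (topspace T) d \<and>
     lower_semicont (prod_topology T T) (\<lambda>(x, y). d x y) \<and>
     (\<forall>U. openin T U \<longrightarrow> ext_metric_open (topspace T) d U)"

text \<open>Continuous 1-Lipschitz functions to the complex numbers; values off \<open>topspace T\<close> are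
  irrelevant.\<close>

definition cont_lip1 :: "'a topology \<Rightarrow> ('a \<Rightarrow> 'a \<Rightarrow> ennreal) \<Rightarrow> ('a \<Rightarrow> complex) set" where
  "cont_lip1 T d = {f. continuous_map T euclidean f \<and>
     (\<forall>x\<in>topspace T. \<forall>y\<in>topspace T. ennreal (cmod (f x - f y)) \<le> d x y)}"

definition separates_points_closed :: "'a topology \<Rightarrow> ('a \<Rightarrow> complex) set \<Rightarrow> bool" where
  "separates_points_closed T \<F> \<longleftrightarrow>
     (\<forall>F x. closedin T F \<and> x \<in> topspace T - F \<longrightarrow>
        (\<exists>f\<in>\<F>. \<exists>c. (\<forall>y\<in>F. f y = c) \<and> f x \<noteq> c))"

definition topometric_completely_regular :: "'a topology \<Rightarrow> ('a \<Rightarrow> 'a \<Rightarrow> ennreal) \<Rightarrow> bool" where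
  "topometric_completely_regular T d \<longleftrightarrow>
     separates_points_closed T (cont_lip1 T d) \<and>
     (\<forall>x\<in>topspace T. \<forall>y\<in>topspace T.
        d x y = (SUP f\<in>cont_lip1 T d. ennreal (cmod (f x - f y))))"

definition topometric_embedding ::
  "'a topology \<Rightarrow> ('a \<Rightarrow> 'a \<Rightarrow> ennreal) \<Rightarrow> 'b topology \<Rightarrow> ('b \<Rightarrow> 'b \<Rightarrow> ennreal) \<Rightarrow> ('a \<Rightarrow> 'b) \<Rightarrow> bool" where
  "topometric_embedding T d S e h \<longleftrightarrow>
     embedding_map T S h \<and>
     (\<forall>x\<in>topspace T. \<forall>y\<in>topspace T. e (h x) (h y) = d x y)"

definition topometric_compactification ::
  "'a topology \<Rightarrow> ('a \<Rightarrow> 'a \<Rightarrow> ennreal) \<Rightarrow> 'b topology \<Rightarrow> ('b \<Rightarrow> 'b \<Rightarrow> ennreal) \<Rightarrow> ('a \<Rightarrow> 'b) \<Rightarrow> bool" where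
  "topometric_compactification T d S e h \<longleftrightarrow>
     topometric S e \<and> compact_space S \<and> topometric_embedding T d S e h \<and>
     S closure_of (h ` topspace T) = topspace S"

text \<open>
  HOL cannot quantify existentially over types, so the type in which the points of the
  compactification live is a parameter. The type \<open>('a \<Rightarrow> complex) \<Rightarrow> complex\<close> is large enough for
  every compactification of a space on \<open>'a\<close> up to isomorphism: lower semi-continuity of the distance
  makes topometric spaces Hausdorff, so a compactification has at most
  \<open>2 ^ 2 ^ card (topspace T)\<close> points.
\<close>

definition admits_compactification_in ::
  "'b itself \<Rightarrow> 'a topology \<Rightarrow> ('a \<Rightarrow> 'a \<Rightarrow> ennreal) \<Rightarrow> bool" where
  "admits_compactification_in (_ :: 'b itself) T d \<longleftrightarrow>
     (\<exists>(S :: 'b topology) e h. topometric_compactification T d S e h)"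

end

(*
  Compact case: lower semi-continuity makes the space Hausdorff, hence normal, and makes closed
  metric neighbourhoods of closed sets closed, as projections of closed sets along a compact factor.
  Running the construction of Urysohn's lemma with these neighbourhoods gives, for closed sets at
  pointwise distance greater than r, a continuous 1-Lipschitz function that is 0 on one and r on
  the other. Complete regularity passes to subspaces by restricting functions. Conversely, evaluate
  the points of a completely regular space at all bounded continuous 1-Lipschitz functions, take the
  closure of the image in the product of discs, and use the supremum distance on it.
*)

theory Submission
  imports Defs
begin

section \<open>Basic facts on topometric spaces\<close>

lemma closedin_lower_semicont_le:
  assumes "lower_semicont T f"
  shows "closedin T {x \<in> topspace T. f x \<le> c}"
proof -
  have "topspace T - {x \<in> topspace T. f x \<le> c} = {x \<in> topspace T. c < f x}"
    by (auto simp: not_le)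
  then show ?thesis
    using assms by (auto simp: closedin_def lower_semicont_def)
qed

lemma topometric_refl: "topometric T d \<Longrightarrow> x \<in> topspace T \<Longrightarrow> d x x = 0"
  by (simp add: topometric_def ext_metric_on_def)

lemma topometric_sym:
  "topometric T d \<Longrightarrow> x \<in> topspace T \<Longrightarrow> y \<in> topspace T \<Longrightarrow> d x y = d y x"
  unfolding topometric_def ext_metric_on_def by blast

lemma topometric_triangle:
  "topometric T d \<Longrightarrow> x \<in> topspace T \<Longrightarrow> y \<in> topspace T \<Longrightarrow> z \<in> topspace T
    \<Longrightarrow> d x z \<le> d x y + d y z"
  unfolding topometric_def ext_metric_on_def by blast

text \<open>The diagonal is the sublevel set of \<open>d\<close> at 0, and lower semi-continuity
  makes sublevel sets closed in the product.\<close>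

lemma topometric_imp_Hausdorff_space:
  assumes "topometric T d"
  shows "Hausdorff_space T"
proof -
  have "closedin (prod_topology T T) {p \<in> topspace (prod_topology T T). (\<lambda>(x, y). d x y) p \<le> 0}"
    using assms by (intro closedin_lower_semicont_le) (simp add: topometric_def)
  moreover have "{p \<in> topspace (prod_topology T T). (\<lambda>(x, y). d x y) p \<le> 0}
      = (\<lambda>x. (x, x)) ` topspace T"
    using assms by (auto simp: topometric_def ext_metric_on_def)
  ultimately show ?thesis
    by (simp add: Hausdorff_space_closedin_diagonal)
qed

text \<open>Asking for an actual point of \<open>K\<close> within \<open>c\<close>, instead of
  bounding an infimum, makes the set a projection of a closed set along the compact factor.\<close>

lemma closedin_metric_neighbourhood:
  assumes "topometric T d" "compact_space T" "closedin T K"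
  shows "closedin T {x \<in> topspace T. \<exists>y\<in>K. d x y \<le> c}"
proof -
  let ?R = "{p \<in> topspace (prod_topology T T). (\<lambda>(x, y). d x y) p \<le> c} \<inter> topspace T \<times> K"
  have "closedin (prod_topology T T) ?R"
    using assms
    by (intro closedin_Int closedin_lower_semicont_le) (auto simp: topometric_def closedin_prod_Times_iff)
  then have "closedin T (fst ` ?R)"
    using closed_map_fst[OF assms(2)] by (auto simp: closed_map_def)
  moreover have "fst ` ?R = {x \<in> topspace T. \<exists>y\<in>K. d x y \<le> c}"
    using closedin_subset[OF assms(3)] by force
  ultimately show ?thesis by simp
qed

section \<open>Urysohn's lemma with Lipschitz control\<close>

text \<open>A strict pointwise bound is what avoiding a closed metric neighbourhood provides. Since
  \<open>ennreal\<close> sends negative reals to 0, it forces positive distances for every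
  \<open>c\<close>.\<close>

definition far :: "('a \<Rightarrow> 'a \<Rightarrow> ennreal) \<Rightarrow> real \<Rightarrow> 'a set \<Rightarrow> 'a set \<Rightarrow> bool" where
  "far d c A B \<longleftrightarrow> (\<forall>x\<in>A. \<forall>y\<in>B. ennreal c < d x y)"

lemma farD: "far d c A B \<Longrightarrow> x \<in> A \<Longrightarrow> y \<in> B \<Longrightarrow> ennreal c < d x y"
  by (simp add: far_def)

lemma far_imp_disjnt:
  assumes "topometric T d" "A \<subseteq> topspace T" "far d c A B"
  shows "A \<inter> B = {}"
  using assms by (force simp: far_def topometric_refl)

text \<open>This is the insertion step of the Urysohn construction. By the triangle inequality no
  point is both within \<open>a\<close> of some \<open>K\<close> and within \<open>b\<close> of some
  \<open>L\<close>; the two finite unions of neighbourhoods are thus disjoint closed sets, which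
  normality separates.\<close>

lemma far_interpolation:
  assumes T: "topometric T d" "compact_space T"
    and fin: "finite \<K>" "finite \<L>"
    and \<K>: "\<And>K a. (K, a) \<in> \<K> \<Longrightarrow> closedin T K \<and> 0 \<le> a"
    and \<L>: "\<And>L b. (L, b) \<in> \<L> \<Longrightarrow> closedin T L \<and> 0 \<le> b"
    and far: "\<And>K a L b. (K, a) \<in> \<K> \<Longrightarrow> (L, b) \<in> \<L> \<Longrightarrow> far d (a + b) K L"
  obtains C D where "closedin T C" "closedin T D" "C \<union> D = topspace T"
    "\<And>K a. (K, a) \<in> \<K> \<Longrightarrow> far d a K D" "\<And>L b. (L, b) \<in> \<L> \<Longrightarrow> far d b C L"
proof -
  define N where "N = (\<lambda>(K, a). {x \<in> topspace T. \<exists>y\<in>K. d x y \<le> ennreal a})"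
  define A where "A = \<Union> (N ` \<K>)"
  define B where "B = \<Union> (N ` \<L>)"
  have A: "closedin T A"
    unfolding A_def N_def using fin \<K> closedin_metric_neighbourhood[OF T]
    by (intro closedin_Union) auto
  have B: "closedin T B"
    unfolding B_def N_def using fin \<L> closedin_metric_neighbourhood[OF T]
    by (intro closedin_Union) auto
  have "A \<inter> B = {}"
  proof (rule ccontr)
    assume "A \<inter> B \<noteq> {}"
    then obtain z K a L b x y where z: "z \<in> topspace T"
      and K: "(K, a) \<in> \<K>" "x \<in> K" "d z x \<le> ennreal a"
      and L: "(L, b) \<in> \<L>" "y \<in> L" "d z y \<le> ennreal b"
      by (auto simp: A_def B_def N_def)
    have xy: "x \<in> topspace T" "y \<in> topspace T"
      using closedin_subset[of T K] closedin_subset[of T L] K L \<K>[OF K(1)] \<L>[OF L(1)] by auto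
    have "d x y \<le> d x z + d z y"
      using T(1) xy z by (intro topometric_triangle)
    also have "\<dots> \<le> ennreal a + ennreal b"
      using K(3) L(3) topometric_sym[OF T(1) z xy(1)] by (intro add_mono) auto
    also have "\<dots> = ennreal (a + b)"
      using \<K>[OF K(1)] \<L>[OF L(1)] by simp
    finally show False
      using farD[OF far[OF K(1) L(1)] K(2) L(2)] by simp
  qed
  moreover have "normal_space T"
    using T topometric_imp_Hausdorff_space compact_Hausdorff_or_regular_imp_normal_space by blast
  \<comment> \<open>The dual form of normality shrinks the open cover by the complements of
    \<open>B\<close> and \<open>A\<close> to a closed cover. Avoiding these neighbourhoods gives the
    strict distance bounds.\<close>
  ultimately obtain C D where CD: "closedin T C" "closedin T D" "C \<subseteq> topspace T - B"
      "D \<subseteq> topspace T - A" "C \<union> D = topspace T"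
    using A B closedin_subset[OF A] closedin_subset[OF B] unfolding normal_space_dual
    by (metis Diff_Int Diff_empty inf_commute openin_diff openin_topspace)
  have "far d a K D" if K: "(K, a) \<in> \<K>" for K a
    unfolding far_def
  proof (intro ballI)
    fix x y assume xy: "x \<in> K" "y \<in> D"
    then have "y \<in> topspace T" "x \<in> topspace T" "y \<notin> A"
      using CD closedin_subset \<K>[OF K] by blast+
    then show "ennreal a < d x y"
      using K xy topometric_sym[OF T(1), of x y] by (force simp: A_def N_def not_le)
  qed
  moreover have "far d b C L" if L: "(L, b) \<in> \<L>" for L b
    unfolding far_def
  proof (intro ballI)
    fix x y assume xy: "x \<in> C" "y \<in> L"
    then have "x \<in> topspace T" "x \<notin> B"
      using CD by blast+
    then show "ennreal b < d x y"
      using L xy by (force simp: B_def N_def not_le)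
  qed
  ultimately show thesis
    using CD that by blast
qed

text \<open>
  Positive distance does not accumulate along a chain of sets, so the Urysohn family has to be
  built one index at a time, keeping all pairwise distances under control.
\<close>

lemma far_family:
  fixes q :: "nat \<Rightarrow> real"
  assumes T: "topometric T d" "compact_space T"
    and FG: "closedin T F" "closedin T G" "far d r F G"
    and q: "\<And>n. 0 < q n" "\<And>n. q n < r"
  obtains K L where "\<And>n. closedin T (K n)" "\<And>n. closedin T (L n)"
    "\<And>n. K n \<union> L n = topspace T"
    "\<And>n. far d (q n) F (L n)" "\<And>n. far d (r - q n) (K n) G"
    "\<And>m n. q m < q n \<Longrightarrow> far d (q n - q m) (K m) (L n)"
proof -
  \<comment> \<open>The pair at \<open>n\<close> will lie inside the sets where the Urysohn function
    is \<le> \<open>q n\<close> and \<ge> \<open>q n\<close>; \<open>F\<close> and \<open>G\<close>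
    act as indices 0 and \<open>r\<close>. Only earlier pairs are mentioned, as the recursion
    requires.\<close>
  define P where "P = (\<lambda>f n p. closedin T (fst p) \<and> closedin T (snd p)
    \<and> fst p \<union> snd p = topspace T \<and> far d (q n) F (snd p) \<and> far d (r - q n) (fst p) G
    \<and> (\<forall>i<n. (q i < q n \<longrightarrow> far d (q n - q i) (fst (f i)) (snd p))
           \<and> (q n < q i \<longrightarrow> far d (q i - q n) (fst p) (snd (f i)))))"
  have "\<exists>f. \<forall>n. P f n (f n)"
  proof (rule dependent_wellorder_choice)
    \<comment> \<open>Here \<open>r\<close> is a candidate pair and hides the real bound of the same
      name.\<close>
    fix r and f g :: "nat \<Rightarrow> 'a set \<times> 'a set" and x :: nat
    assume "\<And>y. y < x \<Longrightarrow> f y = g y"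
    then show "P f x r = P g x r" by (simp add: P_def)
  next
    fix n :: nat and f :: "nat \<Rightarrow> 'a set \<times> 'a set"
    assume f: "\<And>i. i < n \<Longrightarrow> P f i (f i)"
    have f_far: "far d (q j - q i) (fst (f i)) (snd (f j))" if "i < n" "j < n" "q i < q j" for i j
      using f[OF that(1)] f[OF that(2)] that(3)
      by (cases i j rule: linorder_cases) (auto simp: P_def)
    \<comment> \<open>Each radius is the gap between an old index and \<open>q n\<close>. The radii
      of a lower and an upper entry therefore add up to the gap between their own indices, a
      distance already secured.\<close>
    define \<K> where "\<K> = insert (F, q n) ((\<lambda>i. (fst (f i), q n - q i)) ` {i. i < n \<and> q i < q n})"
    define \<L> where "\<L> = insert (G, r - q n) ((\<lambda>i. (snd (f i), q i - q n)) ` {i. i < n \<and> q n < q i})"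
    obtain C D where CD: "closedin T C" "closedin T D" "C \<union> D = topspace T"
      "\<And>K a. (K, a) \<in> \<K> \<Longrightarrow> far d a K D" "\<And>L b. (L, b) \<in> \<L> \<Longrightarrow> far d b C L"
    proof (rule far_interpolation[OF T, of \<K> \<L>])
      show "closedin T K \<and> 0 \<le> a" if "(K, a) \<in> \<K>" for K a
        using that FG q[of n] f by (auto simp: \<K>_def P_def)
      show "closedin T L \<and> 0 \<le> b" if "(L, b) \<in> \<L>" for L b
        using that FG q[of n] f by (auto simp: \<L>_def P_def)
      show "far d (a + b) K L" if "(K, a) \<in> \<K>" "(L, b) \<in> \<L>" for K a L b
        using that FG f f_far by (auto simp: \<K>_def \<L>_def P_def)
    qed (auto simp: \<K>_def \<L>_def)
    have "P f n (C, D)"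
      using CD(1-3) CD(4,5) unfolding P_def \<K>_def \<L>_def by auto
    then show "\<exists>p. P f n p" by blast
  qed
  then obtain f where f: "\<And>n. P f n (f n)" by blast
  show thesis
  proof (rule that[of "\<lambda>n. fst (f n)" "\<lambda>n. snd (f n)"])
    show "far d (q n - q m) (fst (f m)) (snd (f n))" if "q m < q n" for m n
      using f[of m] f[of n] that by (cases m n rule: linorder_cases) (auto simp: P_def)
  qed (use f in \<open>auto simp: P_def\<close>)
qed

lemma topometric_Urysohn:
  assumes T: "topometric T d" "compact_space T"
    and FG: "closedin T F" "closedin T G" "far d r F G" and "0 < r"
  obtains f :: "'a \<Rightarrow> real" where "continuous_map T euclideanreal f"
    "\<And>x y. x \<in> topspace T \<Longrightarrow> y \<in> topspace T \<Longrightarrow> ennreal \<bar>f x - f y\<bar> \<le> d x y"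
    "\<And>x. x \<in> F \<Longrightarrow> f x = 0" "\<And>x. x \<in> G \<Longrightarrow> f x = r"
proof -
  \<comment> \<open>The index set is countable, for the recursion along the natural numbers, and
    dense in (0, \<open>r\<close>).\<close>
  define q where "q = from_nat_into (\<rat> \<inter> {0<..<r})"
  have ne: "\<rat> \<inter> {0<..<r} \<noteq> {}"
    using Rats_dense_in_real[OF \<open>0 < r\<close>] by auto
  have q: "0 < q n" "q n < r" for n
    using from_nat_into[OF ne, of n] by (auto simp: q_def)
  have dense: "\<exists>n. a < q n \<and> q n < b" if "a < b" "a < r" "0 < b" for a b
  proof -
    have "max a 0 < min b r"
      using that \<open>0 < r\<close> by auto
    then obtain s where "s \<in> \<rat>" "max a 0 < s" "s < min b r"
      using Rats_dense_in_real by blast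
    moreover from this have "s \<in> \<rat> \<inter> {0<..<r}" by auto
    then obtain n where "q n = s"
      using from_nat_into_surj[OF countable_Int1[OF countable_rat]] q_def by metis
    ultimately show ?thesis by auto
  qed
  obtain K L where KL: "\<And>n. closedin T (K n)" "\<And>n. closedin T (L n)"
    and un: "\<And>n. K n \<union> L n = topspace T"
    and F: "\<And>n. far d (q n) F (L n)" and G: "\<And>n. far d (r - q n) (K n) G"
    and far: "\<And>m n. q m < q n \<Longrightarrow> far d (q n - q m) (K m) (L n)"
    by (rule far_family[of T d F G r q, OF T FG q]) (rule that)
  have disj: "K m \<inter> L n = {}" if "q m < q n" for m n
    using far_imp_disjnt[OF T(1) _ far[OF that]] KL closedin_subset by blast
  \<comment> \<open>Inserting \<open>r\<close> gives a value at points in no \<open>K n\<close> and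
    bounds the function by \<open>r\<close>.\<close>
  define f where "f x = Inf (insert r {q n | n. x \<in> K n})" for x
  have bdd: "bdd_below (insert r {q n | n. x \<in> K n})" for x
    using q(1) \<open>0 < r\<close> by (intro bdd_belowI[of _ 0]) (auto intro: less_imp_le)
  have f_le: "f x \<le> q n" if "x \<in> K n" for x n
    unfolding f_def using that by (intro cInf_lower[OF _ bdd]) auto
  have f_le_r: "f x \<le> r" for x
    unfolding f_def by (intro cInf_lower[OF _ bdd]) auto
  have f_nonneg: "0 \<le> f x" for x
    unfolding f_def using q(1) \<open>0 < r\<close> by (intro cInf_greatest) (auto intro: less_imp_le)
  have f_less: "\<exists>n. x \<in> K n \<and> q n < a" if "f x < a" "a \<le> r" for x a
    using that cInf_lessD[of "insert r {q n | n. x \<in> K n}" a] by (auto simp: f_def)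
  \<comment> \<open>A point outside \<open>K n\<close> lies in \<open>L n\<close>, which misses
    every \<open>K m\<close> of smaller index.\<close>
  have f_ge: "q n \<le> f x" if x: "x \<in> topspace T" "x \<notin> K n" for x n
  proof (rule ccontr)
    assume "\<not> q n \<le> f x"
    then obtain m where "x \<in> K m" "q m < q n"
      using f_less[of x "q n"] q(2)[of n] by force
    then show False
      using disj[of m n] un[of n] x by blast
  qed
  have "continuous_map T euclideanreal f"
    unfolding continuous_map_upper_lower_semicontinuous_lt
  proof (intro conjI allI)
    fix a
    show "openin T {x \<in> topspace T. a < f x}"
    proof (subst openin_subopen, intro ballI)
      fix x assume "x \<in> {x \<in> topspace T. a < f x}"
      then have x: "x \<in> topspace T" "a < f x" by auto
      show "\<exists>U. openin T U \<and> x \<in> U \<and> U \<subseteq> {x \<in> topspace T. a < f x}"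
      \<comment> \<open>For negative \<open>a\<close> the value at \<open>x\<close> may be 0, and no
        index lies below 0.\<close>
      proof (cases "a < 0")
        case True
        then show ?thesis
          using x f_nonneg by (intro exI[of _ "topspace T"]) (auto intro: less_le_trans)
      next
        case False
        then obtain n where n: "a < q n" "q n < f x"
          using dense[of a "f x"] x(2) f_le_r[of x] by auto
        then have "x \<in> topspace T - K n"
          using x(1) f_le[of x n] by auto
        moreover have "topspace T - K n \<subseteq> {x \<in> topspace T. a < f x}"
          using n(1) f_ge by (auto intro: less_le_trans)
        ultimately show ?thesis
          using KL(1) by (intro exI[of _ "topspace T - K n"]) auto
      qed
    qed
    show "openin T {x \<in> topspace T. f x < a}"
    proof (subst openin_subopen, intro ballI)
      fix x assume "x \<in> {x \<in> topspace T. f x < a}"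
      then have x: "x \<in> topspace T" "f x < a" by auto
      show "\<exists>U. openin T U \<and> x \<in> U \<and> U \<subseteq> {x \<in> topspace T. f x < a}"
      \<comment> \<open>For \<open>a > r\<close> the point may lie in no \<open>K m\<close>, its
        value being the default \<open>r\<close>.\<close>
      proof (cases "a > r")
        case True
        then show ?thesis
          using x f_le_r by (intro exI[of _ "topspace T"]) (auto intro: le_less_trans)
      next
        case False
        then obtain m where m: "x \<in> K m" "q m < a"
          using f_less[of x a] x(2) by auto
        \<comment> \<open>A second index is needed because \<open>L n\<close> misses
          \<open>K m\<close> only when \<open>q m < q n\<close>. The complement of
          \<open>L n\<close> is then an open neighbourhood of \<open>x\<close> inside
          \<open>K n\<close>.\<close>
        obtain n where n: "q m < q n" "q n < a"
          using dense[of "q m" a] m(2) q[of m] by auto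
        have "x \<in> topspace T - L n"
          using disj[OF n(1)] m(1) x(1) by auto
        moreover have "topspace T - L n \<subseteq> {x \<in> topspace T. f x < a}"
          using n(2) f_le un[of n] by (blast intro: le_less_trans)
        ultimately show ?thesis
          using KL(2) by (intro exI[of _ "topspace T - L n"]) auto
      qed
    qed
  qed
  moreover have "ennreal \<bar>f x - f y\<bar> \<le> d x y" if "x \<in> topspace T" "y \<in> topspace T" for x y
  proof -
    have lip: "ennreal (f y - f x) \<le> d x y"
      if xy: "x \<in> topspace T" "y \<in> topspace T" and less: "f x < f y" for x y
    proof (rule ccontr)
      assume "\<not> ennreal (f y - f x) \<le> d x y"
      then have lt: "d x y < ennreal (f y - f x)" by simp
      then obtain c where c: "d x y = ennreal c" "0 \<le> c" "c < f y - f x"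
        using less by (cases "d x y") (auto simp: ennreal_less_iff)
      \<comment> \<open>Half the excess of \<open>f y - f x\<close> over \<open>d x y\<close>:
        indices above \<open>f y - e\<close> and below \<open>f x + e\<close> still differ by more
        than \<open>c\<close>.\<close>
      define e where "e = (f y - f x - c) / 2"
      have "e > 0" using c by (simp add: e_def)
      \<comment> \<open>Cutting at \<open>f y\<close> keeps \<open>q m < f y\<close>, which leaves
        room for a larger index \<open>q n\<close> below \<open>f y\<close>.\<close>
      have "f x < min (f x + e) (f y)" "min (f x + e) (f y) \<le> r"
        using \<open>e > 0\<close> less f_le_r[of y] by auto
      then obtain m where m: "x \<in> K m" "q m < f x + e" "q m < f y"
        using f_less[of x "min (f x + e) (f y)"] by auto
      obtain n where n: "max (f y - e) (q m) < q n" "q n < f y"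
        using dense[of "max (f y - e) (q m)" "f y"] m q \<open>e > 0\<close> f_le_r[of y] f_nonneg[of x] less
        by (force simp: less_max_iff_disj)
      have "y \<in> L n"
        using f_le[of y n] n un[of n] xy by force
      then have "ennreal (q n - q m) < d x y"
        using farD[OF far m(1)] n(1) by simp
      then have "q n - q m < c"
        using n(1) c by (simp add: ennreal_less_iff)
      then show False
        using n m by (simp add: e_def field_simps)
    qed
    show ?thesis
      using lip[OF that] lip[OF that(2,1)] topometric_sym[OF T(1) that]
      by (cases "f x" "f y" rule: linorder_cases) auto
  qed
  \<comment> \<open>\<open>F\<close> misses every \<open>L n\<close>, so it lies in every
    \<open>K n\<close>, and the indices come arbitrarily close to 0.\<close>
  moreover have "f x = 0" if x: "x \<in> F" for x
  proof (rule ccontr)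
    have xT: "x \<in> topspace T" using x FG closedin_subset by blast
    assume "f x \<noteq> 0"
    then obtain n where n: "0 < q n" "q n < f x"
      using dense[of 0 "f x"] f_nonneg[of x] \<open>0 < r\<close> by auto
    have "x \<in> K n"
      using far_imp_disjnt[OF T(1) closedin_subset[OF FG(1)] F, of n] x xT un[of n] by blast
    then show False
      using f_le n by force
  qed
  \<comment> \<open>\<open>G\<close> misses every \<open>K n\<close>, so only the inserted
    \<open>r\<close> remains in the infimum.\<close>
  moreover have "f x = r" if x: "x \<in> G" for x
  proof -
    have "x \<notin> K n" for n
      using far_imp_disjnt[OF T(1) closedin_subset[OF KL(1)] G, of n] x by blast
    then show ?thesis by (simp add: f_def)
  qed
  ultimately show thesis using that by blast
qed

section \<open>Complete regularity of compact topometric spaces\<close>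

lemma of_real_in_cont_lip1:
  fixes f :: "'a \<Rightarrow> real"
  assumes "continuous_map T euclideanreal f"
    and "\<And>x y. x \<in> topspace T \<Longrightarrow> y \<in> topspace T \<Longrightarrow> ennreal \<bar>f x - f y\<bar> \<le> d x y"
  shows "(\<lambda>x. complex_of_real (f x)) \<in> cont_lip1 T d"
proof -
  have "continuous_map T euclidean (complex_of_real \<circ> f)"
    using assms(1) by (rule continuous_map_compose) (simp add: continuous_on_of_real)
  then show ?thesis
    using assms(2) by (simp add: cont_lip1_def o_def flip: of_real_diff)
qed

lemma cont_lip1_SUP_le:
  assumes "x \<in> topspace T" "y \<in> topspace T"
  shows "(SUP f\<in>cont_lip1 T d. ennreal (cmod (f x - f y))) \<le> d x y"
  using assms by (auto intro!: SUP_least simp: cont_lip1_def)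

theorem compact_topometric_imp_completely_regular:
  assumes T: "topometric T d" "compact_space T"
  shows "topometric_completely_regular T d"
  unfolding topometric_completely_regular_def
proof (intro conjI ballI)
  have sing: "closedin T {x}" if "x \<in> topspace T" for x
    using topometric_imp_Hausdorff_space[OF T(1)] that by (rule closedin_Hausdorff_singleton)
  show "separates_points_closed T (cont_lip1 T d)"
    unfolding separates_points_closed_def
  proof (intro allI impI, elim conjE)
    fix F x assume F: "closedin T F" and x: "x \<in> topspace T - F"
    have "ext_metric_open (topspace T) d (topspace T - F)"
      using T(1) F by (auto simp: topometric_def)
    then obtain s where s: "s > 0" "{y \<in> topspace T. d x y < s} \<subseteq> topspace T - F"
      using x by (auto simp: ext_metric_open_def)
    \<comment> \<open>The radius \<open>s\<close> may be infinite and \<open>far\<close> is strict;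
      \<open>u\<close> is finite, positive and below every distance from \<open>x\<close> to
      \<open>F\<close>.\<close>
    obtain u where u: "0 < u" "u < s"
      using dense[OF s(1)] by blast
    then obtain r where r: "u = ennreal r" "r > 0"
      by (cases u) auto
    have "far d r {x} F"
      using s(2) u r closedin_subset[OF F] unfolding far_def
      by (auto simp: subset_iff not_less intro: less_le_trans)
    then obtain f :: "'a \<Rightarrow> real" where f: "continuous_map T euclideanreal f"
      "\<And>x y. x \<in> topspace T \<Longrightarrow> y \<in> topspace T \<Longrightarrow> ennreal \<bar>f x - f y\<bar> \<le> d x y"
      "f x = 0" "\<And>y. y \<in> F \<Longrightarrow> f y = r"
      using topometric_Urysohn[OF T sing F _ \<open>r > 0\<close>] x by (metis DiffD1 singletonI)
    show "\<exists>f\<in>cont_lip1 T d. \<exists>c. (\<forall>y\<in>F. f y = c) \<and> f x \<noteq> c"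
      by (rule bexI[OF _ of_real_in_cont_lip1[OF f(1,2)]]) (use f(3,4) r in auto)
  qed
next
  fix x y assume xy: "x \<in> topspace T" "y \<in> topspace T"
  have sing: "closedin T {x}" if "x \<in> topspace T" for x
    using topometric_imp_Hausdorff_space[OF T(1)] that by (rule closedin_Hausdorff_singleton)
  let ?S = "SUP f\<in>cont_lip1 T d. ennreal (cmod (f x - f y))"
  have "d x y \<le> ?S"
  proof (rule ccontr)
    assume "\<not> d x y \<le> ?S"
    \<comment> \<open>An intermediate \<open>u\<close> is finite even when \<open>d x y\<close> is
      infinite. The Urysohn function for the two singletons has difference \<open>u\<close>, more
      than the supremum.\<close>
    then obtain u where u: "?S < u" "u < d x y"
      using dense[of ?S "d x y"] by (auto simp: not_le)
    have "0 < u"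
      using u(1) by (rule le_less_trans[OF zero_le])
    then obtain r where r: "u = ennreal r" "r > 0"
      using u(2) by (cases u) auto
    have "far d r {x} {y}"
      using u r by (simp add: far_def)
    then obtain f :: "'a \<Rightarrow> real" where f: "continuous_map T euclideanreal f"
      "\<And>x y. x \<in> topspace T \<Longrightarrow> y \<in> topspace T \<Longrightarrow> ennreal \<bar>f x - f y\<bar> \<le> d x y"
      "f x = 0" "f y = r"
      using topometric_Urysohn[OF T sing sing _ \<open>r > 0\<close>] xy by (metis singletonI)
    have "ennreal (cmod (complex_of_real (f x) - complex_of_real (f y))) \<le> ?S"
      by (rule SUP_upper2[OF of_real_in_cont_lip1[OF f(1,2)]]) auto
    then show False
      using f(3,4) u r by (simp add: norm_minus_commute)
  qed
  then show "d x y = ?S"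
    using cont_lip1_SUP_le[OF xy] by (rule antisym)
qed

section \<open>Complete regularity of subspaces\<close>

text \<open>Functions on \<open>S\<close> pull back along \<open>h\<close>. Images of closed sets
  are traces of closed sets of \<open>S\<close>, so separation is inherited, and the pulled-back
  functions already attain \<open>d\<close> as a supremum.\<close>

lemma topometric_embedding_completely_regular:
  assumes h: "topometric_embedding T d S e h" and S: "topometric_completely_regular S e"
  shows "topometric_completely_regular T d"
proof -
  have emb: "embedding_map T S h"
    and iso: "\<And>x y. x \<in> topspace T \<Longrightarrow> y \<in> topspace T \<Longrightarrow> e (h x) (h y) = d x y"
    using h by (auto simp: topometric_embedding_def)
  have cont: "continuous_map T S h"
    using emb homeomorphic_imp_continuous_map[of T _ h]
    by (force simp: embedding_map_def continuous_map_in_subtopology)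
  have hS: "h x \<in> topspace S" if "x \<in> topspace T" for x
    using cont that by (auto simp: continuous_map_def)
  have pull: "g \<circ> h \<in> cont_lip1 T d" if "g \<in> cont_lip1 S e" for g
  proof -
    have "continuous_map T euclidean (g \<circ> h)"
      using that by (intro continuous_map_compose[OF cont]) (simp add: cont_lip1_def)
    then show ?thesis
      using that hS by (auto simp: cont_lip1_def simp flip: iso)
  qed
  show ?thesis
    unfolding topometric_completely_regular_def
  proof (intro conjI ballI)
    show "separates_points_closed T (cont_lip1 T d)"
      unfolding separates_points_closed_def
    proof (intro allI impI, elim conjE)
      fix F x assume F: "closedin T F" and x: "x \<in> topspace T - F"
      have hom: "homeomorphic_map T (subtopology S (h ` topspace T)) h"
        using emb by (simp add: embedding_map_def)
      have "closedin (subtopology S (h ` topspace T)) (h ` F)"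
        using homeomorphic_imp_closed_map[OF hom] F by (simp add: closed_map_def)
      then obtain C where C: "closedin S C" "h ` F = C \<inter> h ` topspace T"
        by (auto simp: closedin_subtopology)
      have "inj_on h (topspace T)"
        using hom by (rule homeomorphic_imp_injective_map)
      then have "h x \<notin> h ` F"
        using x closedin_subset[OF F] by (auto simp: inj_on_def subset_iff)
      then have "h x \<in> topspace S - C"
        using x C(2) hS by auto
      then obtain g c where g: "g \<in> cont_lip1 S e" "\<forall>y\<in>C. g y = c" "g (h x) \<noteq> c"
        using S C(1) by (force simp: topometric_completely_regular_def separates_points_closed_def)
      have "\<forall>y\<in>F. (g \<circ> h) y = c"
        using g(2) C(2) by auto
      then show "\<exists>f\<in>cont_lip1 T d. \<exists>c. (\<forall>y\<in>F. f y = c) \<and> f x \<noteq> c"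
        using g pull by (metis comp_apply)
    qed
    fix x y assume xy: "x \<in> topspace T" "y \<in> topspace T"
    have "d x y = (SUP g\<in>cont_lip1 S e. ennreal (cmod (g (h x) - g (h y))))"
      using S iso[OF xy] hS[OF xy(1)] hS[OF xy(2)] by (simp add: topometric_completely_regular_def)
    also have "\<dots> \<le> (SUP f\<in>cont_lip1 T d. ennreal (cmod (f x - f y)))"
      using pull by (intro SUP_mono) (metis comp_apply order_refl)
    finally show "d x y = (SUP f\<in>cont_lip1 T d. ennreal (cmod (f x - f y)))"
      using cont_lip1_SUP_le[OF xy] by (rule antisym)
  qed
qed

lemma admits_compactification_imp_completely_regular:
  "admits_compactification_in TYPE('b) T d \<Longrightarrow> topometric_completely_regular T d"
  by (auto simp: admits_compactification_in_def topometric_compactification_def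
      intro: topometric_embedding_completely_regular compact_topometric_imp_completely_regular)

section \<open>Compactification of a completely regular space\<close>

text \<open>Boundedness confines each evaluation to a disc, so that Tychonoff's theorem applies to
  the product.\<close>

definition bounded_cont_lip1 :: "'a topology \<Rightarrow> ('a \<Rightarrow> 'a \<Rightarrow> ennreal) \<Rightarrow> ('a \<Rightarrow> complex) set" where
  "bounded_cont_lip1 T d = {f \<in> cont_lip1 T d. bounded (f ` topspace T)}"

text \<open>Lets bounded functions replace arbitrary ones: the distance to \<open>c\<close> is
  1-Lipschitz, and truncation keeps its zeros and all its values up to \<open>M\<close>.\<close>

lemma truncation_in_bounded_cont_lip1:
  assumes f: "f \<in> cont_lip1 T d" and "0 \<le> M"
  shows "(\<lambda>x. complex_of_real (min (cmod (f x - c)) M)) \<in> bounded_cont_lip1 T d"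
proof -
  have "continuous_map T euclideanreal ((\<lambda>z. min (cmod (z - c)) M) \<circ> f)"
    using f by (intro continuous_map_compose[of _ euclidean])
      (auto simp: cont_lip1_def intro!: continuous_intros)
  moreover have "ennreal \<bar>min (cmod (f x - c)) M - min (cmod (f y - c)) M\<bar> \<le> d x y"
    if "x \<in> topspace T" "y \<in> topspace T" for x y
  proof -
    have "\<bar>cmod (f x - c) - cmod (f y - c)\<bar> \<le> cmod (f x - f y)"
      using norm_triangle_ineq3[of "f x - c" "f y - c"] by simp
    then have "\<bar>min (cmod (f x - c)) M - min (cmod (f y - c)) M\<bar> \<le> cmod (f x - f y)"
      by linarith
    then show ?thesis
      using f that order_trans[OF ennreal_leI] by (auto simp: cont_lip1_def)
  qed
  ultimately have "(\<lambda>x. complex_of_real (min (cmod (f x - c)) M)) \<in> cont_lip1 T d"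
    by (intro of_real_in_cont_lip1) (auto simp: o_def)
  moreover have "bounded ((\<lambda>x. complex_of_real (min (cmod (f x - c)) M)) ` topspace T)"
    using \<open>0 \<le> M\<close> by (auto simp: bounded_iff intro!: exI[of _ M])
  ultimately show ?thesis by (simp add: bounded_cont_lip1_def)
qed

theorem completely_regular_imp_compactification:
  fixes T :: "'a topology"
  assumes T: "topometric T d" and reg: "topometric_completely_regular T d"
  shows "admits_compactification_in TYPE(('a \<Rightarrow> complex) \<Rightarrow> complex) T d"
proof -
  define I where "I = bounded_cont_lip1 T d"
  have I: "f \<in> cont_lip1 T d" if "f \<in> I" for f
    using that by (simp add: I_def bounded_cont_lip1_def)
  have "\<exists>B. \<forall>x\<in>topspace T. cmod (f x) \<le> B" if "f \<in> I" for f
    using that by (simp add: I_def bounded_cont_lip1_def bounded_iff)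
  then obtain B where B: "\<And>f x. f \<in> I \<Longrightarrow> x \<in> topspace T \<Longrightarrow> cmod (f x) \<le> B f"
    by metis
  define P where "P = product_topology (\<lambda>f. subtopology euclidean (cball (0::complex) (B f))) I"
  \<comment> \<open>The evaluation map; restricting to \<open>I\<close> makes its values
    extensional, like all points of the product.\<close>
  define h where "h = (\<lambda>x. restrict (\<lambda>f :: 'a \<Rightarrow> complex. f x) I)"
  define S where "S = subtopology P (P closure_of (h ` topspace T))"
  define e where "e = (\<lambda>\<xi> \<eta> :: ('a \<Rightarrow> complex) \<Rightarrow> complex. SUP f\<in>I. ennreal (cmod (\<xi> f - \<eta> f)))"
  have topS: "topspace S = P closure_of (h ` topspace T)"
    by (simp add: S_def closure_of_subset_topspace Int_absorb1)
  have SP: "topspace S \<subseteq> (\<Pi>\<^sub>E f\<in>I. cball 0 (B f))"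
    using closure_of_subset_topspace[of P] by (simp add: topS P_def)
  have "compact_space P"
    by (auto simp: P_def compact_space_product_topology intro!: compact_space_subtopology)
  then have "compact_space S"
    unfolding S_def by (intro compact_space_subtopology closedin_compact_space) auto
  have hP: "continuous_map T P h"
    using I B by (auto simp: P_def h_def continuous_map_componentwise cont_lip1_def
        continuous_map_in_subtopology)
  then have hT: "h ` topspace T \<subseteq> topspace P"
    by (auto simp: continuous_map_def)
  then have hS: "h ` topspace T \<subseteq> topspace S"
    unfolding topS by (rule closure_of_subset)
  have contS: "continuous_map S euclidean (\<lambda>\<xi>. \<xi> f)" if "f \<in> I" for f
    using continuous_map_product_projection[OF that, of "\<lambda>f. subtopology euclidean (cball 0 (B f))"]
    by (auto simp: S_def P_def continuous_map_in_subtopology intro: continuous_map_from_subtopology)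

  have metric: "ext_metric_on (topspace S) e"
    unfolding ext_metric_on_def
  proof (intro conjI ballI)
    fix \<xi> \<eta> assume S: "\<xi> \<in> topspace S" "\<eta> \<in> topspace S"
    show "e \<xi> \<eta> = e \<eta> \<xi>"
      by (simp add: e_def norm_minus_commute)
    have "\<xi> = \<eta>" if "\<forall>f\<in>I. \<xi> f = \<eta> f"
      using PiE_ext[of \<xi> I _ \<eta>] S SP that by blast
    then show "e \<xi> \<eta> = 0 \<longleftrightarrow> \<xi> = \<eta>"
      unfolding e_def bot_ennreal[symmetric] SUP_bot_conv by (auto simp: bot_ennreal)
    fix \<zeta>
    have "ennreal (cmod (\<xi> f - \<zeta> f)) \<le> e \<xi> \<eta> + e \<eta> \<zeta>" if "f \<in> I" for f
    proof -
      have "ennreal (cmod (\<xi> f - \<zeta> f)) \<le> ennreal (cmod (\<xi> f - \<eta> f)) + ennreal (cmod (\<eta> f - \<zeta> f))"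
        using norm_triangle_ineq[of "\<xi> f - \<eta> f" "\<eta> f - \<zeta> f"]
        by (simp flip: ennreal_plus)
      also have "\<dots> \<le> e \<xi> \<eta> + e \<eta> \<zeta>"
        unfolding e_def using that by (intro add_mono SUP_upper)
      finally show ?thesis .
    qed
    then have "(SUP f\<in>I. ennreal (cmod (\<xi> f - \<zeta> f))) \<le> e \<xi> \<eta> + e \<eta> \<zeta>"
      by (rule SUP_least)
    then show "e \<xi> \<zeta> \<le> e \<xi> \<eta> + e \<eta> \<zeta>"
      by (simp add: e_def)
  qed

  have lsc: "lower_semicont (prod_topology S S) (\<lambda>(\<xi>, \<eta>). e \<xi> \<eta>)"
    unfolding lower_semicont_def
  proof
    fix r
    \<comment> \<open>A supremum exceeds \<open>r\<close> exactly when one of its terms does, so the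
      superlevel set is a union of open sets, one for each coordinate.\<close>
    have "openin (prod_topology S S)
        {p \<in> topspace (prod_topology S S). ennreal (cmod (fst p f - snd p f)) \<in> {r<..}}"
      if f: "f \<in> I" for f
    proof (rule openin_continuous_map_preimage[where Y = euclidean])
      have "continuous_map (prod_topology S S) euclidean ((\<lambda>\<xi>. \<xi> f) \<circ> fst)"
        "continuous_map (prod_topology S S) euclidean ((\<lambda>\<xi>. \<xi> f) \<circ> snd)"
        using contS[OF f] by (auto intro: continuous_map_compose continuous_map_fst continuous_map_snd)
      then have "continuous_map (prod_topology S S) euclideanreal (\<lambda>p. cmod (fst p f - snd p f))"
        by (intro continuous_map_norm continuous_map_diff) (auto simp: o_def)
      then have "continuous_map (prod_topology S S) euclidean
          (ennreal \<circ> (\<lambda>p. cmod (fst p f - snd p f)))"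
        by (rule continuous_map_compose) (simp add: continuous_on_ennreal)
      then show "continuous_map (prod_topology S S) euclidean
          (\<lambda>p. ennreal (cmod (fst p f - snd p f)))"
        by (simp add: o_def)
    qed simp
    then have "openin (prod_topology S S) (\<Union>f\<in>I.
        {p \<in> topspace (prod_topology S S). ennreal (cmod (fst p f - snd p f)) \<in> {r<..}})"
      by blast
    moreover have "(\<Union>f\<in>I. {p \<in> topspace (prod_topology S S).
        ennreal (cmod (fst p f - snd p f)) \<in> {r<..}})
      = {p \<in> topspace (prod_topology S S). r < (\<lambda>(\<xi>, \<eta>). e \<xi> \<eta>) p}"
      by (auto simp: e_def less_SUP_iff)
    ultimately show "openin (prod_topology S S)
        {p \<in> topspace (prod_topology S S). r < (\<lambda>(\<xi>, \<eta>). e \<xi> \<eta>) p}"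
      by simp
  qed

  have fine: "ext_metric_open (topspace S) e U" if U: "openin S U" for U
    unfolding ext_metric_open_def
  proof (intro conjI ballI)
    show "U \<subseteq> topspace S" using U by (rule openin_subset)
    fix \<xi> assume \<xi>: "\<xi> \<in> U"
    obtain V where V: "openin P V" "U = V \<inter> topspace S"
      using U unfolding topS by (auto simp: S_def openin_subtopology)
    \<comment> \<open>A basic box around \<xi> restricts only finitely many coordinates, collected
      in \<open>J\<close> below.\<close>
    obtain W where W: "finite {f \<in> I. W f \<noteq> cball 0 (B f)}"
      "\<forall>f\<in>I. openin (top_of_set (cball 0 (B f))) (W f)" "\<xi> \<in> Pi\<^sub>E I W" "Pi\<^sub>E I W \<subseteq> V"
      using bspec[OF V(1)[unfolded P_def openin_product_topology_alt], of \<xi>] V(2) \<xi>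
      by (simp del: PiE_iff) blast
    define J where "J = {f \<in> I. W f \<noteq> cball 0 (B f)}"
    have "\<exists>\<epsilon>>0. \<forall>z\<in>cball 0 (B f). dist z (\<xi> f) < \<epsilon> \<longrightarrow> z \<in> W f" if "f \<in> J" for f
      using W(2,3) that by (auto simp: J_def openin_euclidean_subtopology_iff PiE_iff)
    then obtain \<epsilon> where \<epsilon>: "\<And>f. f \<in> J \<Longrightarrow> \<epsilon> f > 0"
      "\<And>f z. f \<in> J \<Longrightarrow> z \<in> cball 0 (B f) \<Longrightarrow> dist z (\<xi> f) < \<epsilon> f \<Longrightarrow> z \<in> W f"
      by metis
    \<comment> \<open>The supremum distance controls all coordinates at once, so the least radius
      works; the 1 covers empty \<open>J\<close>.\<close>
    define \<delta> where "\<delta> = Min (insert 1 (\<epsilon> ` J))"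
    have \<delta>: "\<delta> > 0" "\<And>f. f \<in> J \<Longrightarrow> \<delta> \<le> \<epsilon> f"
      using W(1) \<epsilon>(1) by (auto simp: \<delta>_def J_def[symmetric])
    have "\<eta> \<in> U" if \<eta>: "\<eta> \<in> topspace S" "e \<xi> \<eta> < ennreal \<delta>" for \<eta>
    proof -
      have PiE: "\<eta> \<in> (\<Pi>\<^sub>E f\<in>I. cball 0 (B f))"
        using \<eta> SP by blast
      have "\<eta> f \<in> W f" if f: "f \<in> I" for f
      proof (cases "f \<in> J")
        case True
        have "ennreal (cmod (\<xi> f - \<eta> f)) \<le> e \<xi> \<eta>"
          unfolding e_def using f by (rule SUP_upper)
        then have "cmod (\<xi> f - \<eta> f) < \<delta>"
          using \<eta>(2) by (metis ennreal_less_iff le_less_trans norm_ge_zero)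
        then have "dist (\<eta> f) (\<xi> f) < \<epsilon> f"
          using \<delta>(2)[OF True] by (simp add: dist_norm norm_minus_commute)
        then show ?thesis
          using \<epsilon>(2)[OF True] PiE f by (auto simp: PiE_iff)
      next
        case False
        then show ?thesis
          using PiE f by (auto simp: J_def PiE_iff)
      qed
      then have "\<eta> \<in> Pi\<^sub>E I W"
        using PiE by (auto simp: PiE_iff)
      then show ?thesis
        using W(4) V(2) \<eta> by blast
    qed
    then show "\<exists>r>0. {\<eta> \<in> topspace S. e \<xi> \<eta> < r} \<subseteq> U"
      using \<delta>(1) by (intro exI[of _ "ennreal \<delta>"]) auto
  qed

  have iso: "e (h x) (h y) = d x y" if xy: "x \<in> topspace T" "y \<in> topspace T" for x y
  proof -
    have "e (h x) (h y) = (SUP f\<in>I. ennreal (cmod (f x - f y)))"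
      by (simp add: e_def h_def)
    also have "\<dots> = (SUP f\<in>cont_lip1 T d. ennreal (cmod (f x - f y)))"
    proof (rule antisym)
      show "(SUP f\<in>I. ennreal (cmod (f x - f y))) \<le> (SUP f\<in>cont_lip1 T d. ennreal (cmod (f x - f y)))"
        using I by (intro SUP_subset_mono) auto
      show "(SUP f\<in>cont_lip1 T d. ennreal (cmod (f x - f y))) \<le> (SUP f\<in>I. ennreal (cmod (f x - f y)))"
      proof (rule SUP_least)
        fix f assume f: "f \<in> cont_lip1 T d"
        show "ennreal (cmod (f x - f y)) \<le> (SUP f\<in>I. ennreal (cmod (f x - f y)))"
          \<comment> \<open>The truncation with \<open>c = f y\<close> and
            \<open>M = cmod (f x - f y)\<close> takes the value \<open>M\<close> at \<open>x\<close>
            and 0 at \<open>y\<close>.\<close>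
          by (rule SUP_upper2[OF truncation_in_bounded_cont_lip1[OF f norm_ge_zero[of "f x - f y"],
                of "f y", folded I_def]]) simp
      qed
    qed
    also have "\<dots> = d x y"
      using reg xy by (simp add: topometric_completely_regular_def)
    finally show ?thesis .
  qed

  have "embedding_map T S h"
    unfolding embedding_map_def
  proof (rule bijective_open_imp_homeomorphic_map)
    show "continuous_map T (subtopology S (h ` topspace T)) h"
      using hP hS[unfolded topS] by (auto simp: S_def continuous_map_in_subtopology)
    show "h ` topspace T = topspace (subtopology S (h ` topspace T))"
      using hS by auto
    show "inj_on h (topspace T)"
      unfolding inj_on_def
    proof (intro ballI impI)
      fix x y assume xy: "x \<in> topspace T" "y \<in> topspace T" "h x = h y"
      then have "d x y = d x x"
        using iso by metis
      then show "x = y"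
        using T xy(1,2) unfolding topometric_def ext_metric_on_def by metis
    qed
    show "open_map T (subtopology S (h ` topspace T)) h"
      unfolding open_map_def
    proof (intro allI impI)
      fix U assume U: "openin T U"
      show "openin (subtopology S (h ` topspace T)) (h ` U)"
      proof (subst openin_subopen, intro ballI)
        fix \<xi> assume "\<xi> \<in> h ` U"
        then obtain x where x: "x \<in> U" "\<xi> = h x" by blast
        have xT: "x \<in> topspace T"
          using x U openin_subset by blast
        have "closedin T (topspace T - U) \<and> x \<in> topspace T - (topspace T - U)"
          using U x xT by auto
        then obtain f c where f: "f \<in> cont_lip1 T d" "\<forall>y\<in>topspace T - U. f y = c" "f x \<noteq> c"
          using reg unfolding topometric_completely_regular_def separates_points_closed_def
          by meson
        \<comment> \<open>\<open>g\<close> vanishes off \<open>U\<close> but not at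
          \<open>x\<close>. Points of the image with nonzero coordinate \<open>g\<close> hence form
          a relatively open neighbourhood of \<open>h x\<close> inside the image of
          \<open>U\<close>.\<close>
        define g where "g = (\<lambda>y. complex_of_real (min (cmod (f y - c)) (cmod (f x - c))))"
        have g: "g \<in> I"
          unfolding I_def g_def by (rule truncation_in_bounded_cont_lip1[OF f(1)]) simp
        let ?V = "{\<eta> \<in> topspace S. \<eta> g \<in> - {0}} \<inter> h ` topspace T"
        have "openin S {\<eta> \<in> topspace S. \<eta> g \<in> - {0}}"
          using contS[OF g] by (rule openin_continuous_map_preimage) auto
        then have "openin (subtopology S (h ` topspace T)) ?V"
          by (auto simp: openin_subtopology)
        moreover have "\<xi> \<in> ?V"
          using x xT hS f(3) g by (auto simp: h_def g_def)
        moreover have "?V \<subseteq> h ` U"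
        proof
          fix \<eta> assume "\<eta> \<in> ?V"
          then obtain y where y: "y \<in> topspace T" "\<eta> = h y" "g y \<noteq> 0"
            using g by (auto simp: h_def)
          then have "f y \<noteq> c"
            by (auto simp: g_def)
          then have "y \<in> U"
            using f(2) y(1) by blast
          then show "\<eta> \<in> h ` U" using y by blast
        qed
        ultimately show "\<exists>V. openin (subtopology S (h ` topspace T)) V \<and> \<xi> \<in> V \<and> V \<subseteq> h ` U"
          by blast
      qed
    qed
  qed
  moreover have "S closure_of (h ` topspace T) = topspace S"
    using hS unfolding topS by (simp add: S_def closure_of_subtopology Int_absorb1)
  ultimately have "topometric_compactification T d S e h"
    using metric lsc fine iso \<open>compact_space S\<close>
    by (auto simp: topometric_compactification_def topometric_embedding_def topometric_def)
  then show ?thesis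
    unfolding admits_compactification_in_def by blast
qed

text \<open>The equivalence uses the type of the constructed product; the second conjunct extends
  necessity to compactifications over any type.\<close>

theorem theorem2p6:
  fixes T :: "'a topology" and d :: "'a \<Rightarrow> 'a \<Rightarrow> ennreal"
  assumes "topometric T d"
  shows "(admits_compactification_in TYPE(('a \<Rightarrow> complex) \<Rightarrow> complex) T d
            \<longleftrightarrow> topometric_completely_regular T d) \<and>
         (admits_compactification_in TYPE('b) T d
            \<longrightarrow> topometric_completely_regular T d)"
  using completely_regular_imp_compactification[OF assms]
    admits_compactification_imp_completely_regular[of T d, where 'b = "('a \<Rightarrow> complex) \<Rightarrow> complex"]
    admits_compactification_imp_completely_regular[of T d, where 'b = 'b]
  by blast

end
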